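(* Let $b>0$, $0<y<1$, and $\mu\in\mathbb{C}$ with $\mathrm{Re}(\mu)>1$. Then the $\mu$th upper incomplete Riemann--Liouville fractional integral, $f\mapsto {}^{RL}_{0}D^{-\mu}\{f;y\}$, defines a bounded (linear) operator $${}^{RL}_{0}D^{-\mu}\{\,\cdot\,;y\}:L^1[0,b]\to L^1[0,b].$$
   Context: For $b>0$, $0<y<1$, $\mathrm{Re}(\mu)>1$, the $\mu$th upper incomplete Riemann--Liouville fractional integral of a function $f:[0,b]\to\mathbb{C}$ is the function of $x\in[0,b]$ given by $${}^{RL}_{0}D_x^{-\mu}\{f(x);y\}={}^{RL}_{0}I_x^{\mu}\{f(x);y\}=\frac{1}{\Gamma(\mu)}\int_{yx}^{x}(x-t)^{\mu-1}f(t)\,\mathrm{d}t .$$ $L^1[0,b]$ denotes the usual Lebesgue space of complex-valued functions on $[0,b]$. *)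

theory Defs
  imports "HOL-Analysis.Analysis"
begin

section \<open>The Lebesgue space of complex-valued integrable functions\<close>

text \<open>
  Functions on a measure space \<open>M\<close> are represented by total functions; only the values on
  \<open>space M\<close> matter for integrability and for equality almost everywhere. The elements of
  \<open>L1 M\<close> are the classes of integrable functions modulo equality almost everywhere.
\<close>

definition L1_rel :: "'a measure \<Rightarrow> (('a \<Rightarrow> complex) \<times> ('a \<Rightarrow> complex)) set" where
  "L1_rel M = {(f, g). integrable M f \<and> integrable M g \<and> (AE x in M. f x = g x)}"

definition L1_class :: "'a measure \<Rightarrow> ('a \<Rightarrow> complex) \<Rightarrow> ('a \<Rightarrow> complex) set" where
  "L1_class M f = L1_rel M `` {f}"

definition L1 :: "'a measure \<Rightarrow> ('a \<Rightarrow> complex) set set" where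
  "L1 M = {f. integrable M f} // L1_rel M"

text \<open>
  The operations on classes, in the style of \<^theory>\<open>HOL.Equiv_Relations\<close>: the unions (and the
  set passed to \<^const>\<open>the_elem\<close>) range over constant families, see the lemmas
  \<open>L1_lift_class\<close>, \<open>L1_add_class\<close>, \<open>L1_scale_class\<close>, \<open>L1_norm_class\<close> below.
\<close>

definition L1_add ::
  "'a measure \<Rightarrow> ('a \<Rightarrow> complex) set \<Rightarrow> ('a \<Rightarrow> complex) set \<Rightarrow> ('a \<Rightarrow> complex) set" where
  "L1_add M F G = (\<Union>f\<in>F. \<Union>g\<in>G. L1_class M (\<lambda>x. f x + g x))"

definition L1_scale ::
  "'a measure \<Rightarrow> complex \<Rightarrow> ('a \<Rightarrow> complex) set \<Rightarrow> ('a \<Rightarrow> complex) set" where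
  "L1_scale M c F = (\<Union>f\<in>F. L1_class M (\<lambda>x. c * f x))"

definition L1_norm :: "'a measure \<Rightarrow> ('a \<Rightarrow> complex) set \<Rightarrow> real" where
  "L1_norm M F = the_elem ((\<lambda>f. integral\<^sup>L M (\<lambda>x. norm (f x))) ` F)"

definition L1_lift ::
  "'a measure \<Rightarrow> (('a \<Rightarrow> complex) \<Rightarrow> ('a \<Rightarrow> complex)) \<Rightarrow> ('a \<Rightarrow> complex) set \<Rightarrow> ('a \<Rightarrow> complex) set"
  where "L1_lift M A F = (\<Union>f\<in>F. L1_class M (A f))"

definition L1_bounded_linear ::
  "'a measure \<Rightarrow> (('a \<Rightarrow> complex) set \<Rightarrow> ('a \<Rightarrow> complex) set) \<Rightarrow> bool" where
  "L1_bounded_linear M T \<longleftrightarrow>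
     T \<in> L1 M \<rightarrow> L1 M \<and>
     (\<forall>F\<in>L1 M. \<forall>G\<in>L1 M. T (L1_add M F G) = L1_add M (T F) (T G)) \<and>
     (\<forall>c. \<forall>F\<in>L1 M. T (L1_scale M c F) = L1_scale M c (T F)) \<and>
     (\<exists>C. \<forall>F\<in>L1 M. L1_norm M (T F) \<le> C * L1_norm M F)"

lemma equiv_L1_rel: "equiv {f. integrable M f} (L1_rel M)"
proof (rule equivI)
  show "L1_rel M \<subseteq> {f. integrable M f} \<times> {f. integrable M f}"
    by (auto simp: L1_rel_def)
  show "refl_on {f. integrable M f} (L1_rel M)"
    by (auto simp: L1_rel_def refl_on_def)
  show "sym (L1_rel M)"
    by (auto simp: L1_rel_def sym_def)
  show "trans (L1_rel M)"
    unfolding trans_def L1_rel_def by auto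
qed

lemma L1_class_eq: "(f, g) \<in> L1_rel M \<Longrightarrow> L1_class M f = L1_class M g"
  unfolding L1_class_def by (rule equiv_class_eq[OF equiv_L1_rel])

lemma L1_class_self: "integrable M f \<Longrightarrow> f \<in> L1_class M f"
  by (simp add: L1_class_def L1_rel_def)

lemma L1_class_in: "integrable M f \<Longrightarrow> L1_class M f \<in> L1 M"
  unfolding L1_class_def L1_def by (rule quotientI) simp

lemma L1_lift_class:
  assumes "(\<lambda>f. L1_class M (A f)) respects L1_rel M" and "integrable M f"
  shows "L1_lift M A (L1_class M f) = L1_class M (A f)"
proof -
  have "L1_class M (A g) = L1_class M (A f)" if "g \<in> L1_class M f" for g
    using that congruentD[OF assms(1)] by (auto simp: L1_class_def)
  then show ?thesis
    using L1_class_self[OF assms(2)] unfolding L1_lift_def by blast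
qed

lemma L1_add_class:
  assumes "integrable M f" and "integrable M g"
  shows "L1_add M (L1_class M f) (L1_class M g) = L1_class M (\<lambda>x. f x + g x)"
proof -
  have "L1_class M (\<lambda>x. f' x + g' x) = L1_class M (\<lambda>x. f x + g x)"
    if "f' \<in> L1_class M f" "g' \<in> L1_class M g" for f' g'
    using that by (intro L1_class_eq) (auto simp: L1_class_def L1_rel_def)
  then show ?thesis
    using L1_class_self[OF assms(1)] L1_class_self[OF assms(2)] unfolding L1_add_def by blast
qed

lemma L1_scale_class:
  assumes "integrable M f"
  shows "L1_scale M c (L1_class M f) = L1_class M (\<lambda>x. c * f x)"
proof -
  have "L1_class M (\<lambda>x. c * f' x) = L1_class M (\<lambda>x. c * f x)"
    if "f' \<in> L1_class M f" for f'
  proof (rule L1_class_eq)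
    have "integrable M f'" and "AE x in M. f x = f' x"
      using that by (auto simp: L1_class_def L1_rel_def)
    moreover from this(2) have "AE x in M. c * f' x = c * f x"
      by (elim eventually_mono) simp
    ultimately show "(\<lambda>x. c * f' x, \<lambda>x. c * f x) \<in> L1_rel M"
      using assms integrable_mult_right[of c M f] integrable_mult_right[of c M f']
      unfolding L1_rel_def by blast
  qed
  then show ?thesis
    using L1_class_self[OF assms] unfolding L1_scale_def by blast
qed

lemma L1_norm_class:
  assumes "integrable M f"
  shows "L1_norm M (L1_class M f) = integral\<^sup>L M (\<lambda>x. norm (f x))"
proof -
  have "integral\<^sup>L M (\<lambda>x. norm (g x)) = integral\<^sup>L M (\<lambda>x. norm (f x))"
    if "g \<in> L1_class M f" for g
    using that by (intro integral_cong_AE) (auto simp: L1_class_def L1_rel_def)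
  then have "(\<lambda>g. integral\<^sup>L M (\<lambda>x. norm (g x))) ` L1_class M f
      = {integral\<^sup>L M (\<lambda>x. norm (f x))}"
    using L1_class_self[OF assms] by blast
  then show ?thesis by (simp add: L1_norm_def)
qed


section \<open>The upper incomplete Riemann--Liouville fractional integral\<close>

definition upper_RL_integrand :: "complex \<Rightarrow> (real \<Rightarrow> complex) \<Rightarrow> real \<Rightarrow> real \<Rightarrow> complex" where
  "upper_RL_integrand \<mu> f x t = complex_of_real (x - t) powr (\<mu> - 1) * f t"

definition upper_RL :: "complex \<Rightarrow> real \<Rightarrow> (real \<Rightarrow> complex) \<Rightarrow> real \<Rightarrow> complex" where
  "upper_RL \<mu> y f x =
     1 / Gamma \<mu> * (LINT t:{y * x..x}|lebesgue. upper_RL_integrand \<mu> f x t)"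

end

theory Submission
  imports Defs
begin

text \<open>
  On the domain of integration the kernel \<open>(x - t) powr (\<mu> - 1)\<close> of the upper incomplete
  Riemann--Liouville integral satisfies \<open>0 \<le> x - t \<le> b\<close>, so that for \<open>Re \<mu> > 1\<close> it is bounded by
  \<open>b powr (Re \<mu> - 1)\<close>: there is no singularity at \<open>t = x\<close>. Cutting the kernel off outside
  \<open>y * x \<le> t \<le> x\<close> turns the operator into an integral operator over the fixed interval \<open>{0..b}\<close>
  with a bounded kernel (\<open>upper_RL_eq_integral_kernel\<close>). It therefore maps an integrable \<open>f\<close> to a
  function whose modulus is at most
  \<open>norm (1 / Gamma \<mu>) * b powr (Re \<mu> - 1) * (\<integral>\<^sub>0\<^sup>b norm (f t))\<close> on all of \<open>{0..b}\<close>
  (\<open>norm_upper_RL_le\<close>), and integrating this constant over \<open>{0..b}\<close> costs one more factor \<open>b\<close>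
  in the operator norm.

  The image is measurable because it is continuous: at a given \<open>x\<close> the kernel is continuous in
  its first argument for every \<open>t\<close> other than the end points \<open>x\<close> and \<open>y * x\<close>, so dominated
  convergence shows that the image of \<open>f\<close> is continuous on \<open>{0..b}\<close> (\<open>continuous_on_upper_RL\<close>).

  The rest is the general passage from an operator on functions to an operator on classes
  (\<open>L1_lift_bounded_linear\<close>).
\<close>

section \<open>Operators on classes induced by operators on functions\<close>

lemma L1_class_cong:
  assumes "integrable M f" "integrable M g" "\<And>x. x \<in> space M \<Longrightarrow> f x = g x"
  shows "L1_class M f = L1_class M g"
  using assms by (intro L1_class_eq) (auto simp: L1_rel_def)

lemma L1_cases:
  assumes "F \<in> L1 M"
  obtains f where "integrable M f" "F = L1_class M f"
  using assms unfolding L1_def L1_class_def by (auto elim: quotientE)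

text \<open>
  Respect for equality almost everywhere and linearity are required pointwise on \<open>space M\<close>. An
  integral operator meets this: changing \<open>f\<close> on a null set affects none of the integrals, and each
  of them is linear in \<open>f\<close>.
\<close>

lemma L1_lift_bounded_linear:
  assumes int: "\<And>f. integrable M f \<Longrightarrow> integrable M (A f)"
    and cong: "\<And>f g x. integrable M f \<Longrightarrow> integrable M g \<Longrightarrow> AE t in M. f t = g t \<Longrightarrow>
                 x \<in> space M \<Longrightarrow> A f x = A g x"
    and add: "\<And>f g x. integrable M f \<Longrightarrow> integrable M g \<Longrightarrow> x \<in> space M \<Longrightarrow>
                 A (\<lambda>t. f t + g t) x = A f x + A g x"
    and scale: "\<And>c f x. integrable M f \<Longrightarrow> x \<in> space M \<Longrightarrow> A (\<lambda>t. c * f t) x = c * A f x"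
    and bound: "\<And>f. integrable M f \<Longrightarrow>
                 (LINT x|M. norm (A f x)) \<le> C * (LINT x|M. norm (f x))"
  shows "(\<lambda>f. L1_class M (A f)) respects L1_rel M" (is ?respects)
    and "L1_bounded_linear M (L1_lift M A)"
proof -
  show resp: ?respects
  proof (rule congruentI)
    fix f g assume "(f, g) \<in> L1_rel M"
    then have fg: "integrable M f" "integrable M g" "AE x in M. f x = g x"
      by (auto simp: L1_rel_def)
    show "L1_class M (A f) = L1_class M (A g)"
      by (rule L1_class_cong[OF int[OF fg(1)] int[OF fg(2)] cong[OF fg]])
  qed
  have lift: "L1_lift M A (L1_class M f) = L1_class M (A f)" if "integrable M f" for f
    by (rule L1_lift_class[OF resp that])
  have scaled: "integrable M (\<lambda>x. c * f x)" if "integrable M f" for c :: complex and f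
    using that by simp
  show "L1_bounded_linear M (L1_lift M A)"
    unfolding L1_bounded_linear_def
  proof (intro conjI ballI allI)
    show "L1_lift M A \<in> L1 M \<rightarrow> L1 M"
      by (auto elim!: L1_cases simp: lift int L1_class_in)
  next
    fix F G assume "F \<in> L1 M" "G \<in> L1 M"
    then obtain f g where f: "integrable M f" "F = L1_class M f"
      and g: "integrable M g" "G = L1_class M g"
      by (metis L1_cases)
    have "L1_class M (A (\<lambda>x. f x + g x)) = L1_class M (\<lambda>x. A f x + A g x)"
      using f(1) g(1) by (intro L1_class_cong) (auto simp: int add)
    with f g show "L1_lift M A (L1_add M F G) = L1_add M (L1_lift M A F) (L1_lift M A G)"
      by (simp add: L1_add_class lift int)
  next
    fix c F assume "F \<in> L1 M"
    then obtain f where f: "integrable M f" "F = L1_class M f"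
      by (metis L1_cases)
    have "L1_class M (A (\<lambda>x. c * f x)) = L1_class M (\<lambda>x. c * A f x)"
      using f(1) by (intro L1_class_cong int scaled scale)
    with f show "L1_lift M A (L1_scale M c F) = L1_scale M c (L1_lift M A F)"
      by (simp add: L1_scale_class lift int scaled)
  next
    show "\<exists>C. \<forall>F\<in>L1 M. L1_norm M (L1_lift M A F) \<le> C * L1_norm M F"
      by (rule exI[of _ C]) (auto elim!: L1_cases simp: lift int L1_norm_class bound)
  qed
qed

section \<open>The truncated kernel\<close>

definition upper_RL_kernel :: "complex \<Rightarrow> real \<Rightarrow> real \<Rightarrow> real \<Rightarrow> complex" where
  "upper_RL_kernel \<mu> y x t =
     indicator {y * x..x} t *\<^sub>R complex_of_real (x - t) powr (\<mu> - 1)"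

lemma norm_upper_RL_kernel_le:
  assumes "0 \<le> y" "x \<in> {0..b}" "Re \<mu> \<ge> 1"
  shows "norm (upper_RL_kernel \<mu> y x t) \<le> b powr (Re \<mu> - 1)"
proof (cases "t \<in> {y * x..x}")
  case True
  moreover have "0 \<le> y * x"
    using assms by simp
  ultimately have "0 \<le> x - t" "x - t \<le> b"
    using assms by auto
  moreover from this have "norm (complex_of_real (x - t) powr (\<mu> - 1)) = (x - t) powr (Re \<mu> - 1)"
    by (subst norm_powr_real_powr) (auto simp del: of_real_diff)
  ultimately show ?thesis
    using True assms by (simp add: upper_RL_kernel_def powr_mono2 del: of_real_diff)
qed (simp add: upper_RL_kernel_def)

text \<open>
  The power is continuous up to the end point \<open>t = x\<close> of the cut-off interval, where the base
  vanishes, because the exponent has positive real part.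
\<close>

lemma upper_RL_kernel_measurable:
  assumes "Re \<mu> > 1"
  shows "upper_RL_kernel \<mu> y x \<in> borel_measurable borel"
  unfolding upper_RL_kernel_def using assms
  by (intro borel_measurable_continuous_on_indicator continuous_on_powr_complex continuous_intros)
     (auto simp del: of_real_diff)

text \<open>
  If \<open>t\<close> lies strictly inside \<open>{y * x..x}\<close> or strictly outside, it stays there for all nearby \<open>x\<close>,
  so the cut-off is locally constant; inside, \<open>x - t\<close> is positive and so away from the branch cut.
\<close>

lemma isCont_upper_RL_kernel:
  assumes "t \<noteq> x" "t \<noteq> y * x"
  shows "isCont (\<lambda>x. upper_RL_kernel \<mu> y x t) x"
proof (cases "y * x < t \<and> t < x")
  case True
  have "isCont (\<lambda>x. complex_of_real (x - t) powr (\<mu> - 1)) x"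
    using True by (intro continuous_intros) (auto simp: complex_nonpos_Reals_iff)
  moreover have "\<forall>\<^sub>F x' in nhds x. y * x' < t \<and> t < x'"
  proof (rule eventually_conj)
    show "\<forall>\<^sub>F x' in nhds x. y * x' < t"
      using True by (intro order_tendstoD(2)[of _ "y * x"] tendsto_intros filterlim_ident) auto
    show "\<forall>\<^sub>F x' in nhds x. t < x'"
      using True by (intro order_tendstoD(1)[of _ x] tendsto_intros filterlim_ident) auto
  qed
  then have "\<forall>\<^sub>F x' in nhds x. upper_RL_kernel \<mu> y x' t = complex_of_real (x' - t) powr (\<mu> - 1)"
    by eventually_elim (simp add: upper_RL_kernel_def)
  ultimately show ?thesis
    by (simp add: isCont_cong)
next
  case False
  then consider "t < y * x" | "x < t"
    using assms by linarith
  then have "\<forall>\<^sub>F x' in nhds x. t < y * x' \<or> x' < t"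
  proof cases
    case 1
    then have "\<forall>\<^sub>F x' in nhds x. t < y * x'"
      by (intro order_tendstoD(1)[of _ "y * x"] tendsto_intros filterlim_ident) auto
    then show ?thesis by eventually_elim simp
  next
    case 2
    then have "\<forall>\<^sub>F x' in nhds x. x' < t"
      by (intro order_tendstoD(2)[of _ x] tendsto_intros filterlim_ident) auto
    then show ?thesis by eventually_elim simp
  qed
  then have "\<forall>\<^sub>F x' in nhds x. upper_RL_kernel \<mu> y x' t = 0"
    by eventually_elim (auto simp: upper_RL_kernel_def)
  then show ?thesis
    by (simp add: isCont_cong)
qed

section \<open>The operator as an integral operator with bounded kernel\<close>

lemma integrable_upper_RL_kernel_mult:
  assumes "0 \<le> y" "Re \<mu> > 1" "x \<in> {0..b}" and f: "integrable (lebesgue_on {0..b}) f"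
  shows "integrable (lebesgue_on {0..b}) (\<lambda>t. upper_RL_kernel \<mu> y x t * f t)"
proof (rule Bochner_Integration.integrable_bound)
  show "integrable (lebesgue_on {0..b}) (\<lambda>t. b powr (Re \<mu> - 1) * norm (f t))"
    using f by simp
  have "upper_RL_kernel \<mu> y x \<in> borel_measurable (lebesgue_on {0..b})"
    using upper_RL_kernel_measurable[OF assms(2)]
    by (intro measurable_restrict_space1 measurable_completion) simp
  then show "(\<lambda>t. upper_RL_kernel \<mu> y x t * f t) \<in> borel_measurable (lebesgue_on {0..b})"
    using f by simp
  show "AE t in lebesgue_on {0..b}. norm (upper_RL_kernel \<mu> y x t * f t)
          \<le> norm (b powr (Re \<mu> - 1) * norm (f t))"
    using norm_upper_RL_kernel_le[of y x b \<mu>] assms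
    by (intro AE_I2) (simp add: norm_mult mult_right_mono)
qed

lemma indicator_upper_RL_integrand:
  assumes "0 \<le> y" "x \<in> {0..b}"
  shows "indicator {y * x..x} t *\<^sub>R upper_RL_integrand \<mu> f x t =
         indicator {0..b} t *\<^sub>R (upper_RL_kernel \<mu> y x t * f t)"
proof -
  have "0 \<le> t" if "y * x \<le> t"
    using that assms by (auto intro: order_trans[of 0 "y * x"])
  then show ?thesis
    using assms by (auto simp: upper_RL_integrand_def upper_RL_kernel_def indicator_def)
qed

lemma set_integrable_upper_RL_integrand:
  assumes "0 \<le> y" "Re \<mu> > 1" "x \<in> {0..b}" "integrable (lebesgue_on {0..b}) f"
  shows "set_integrable lebesgue {y * x..x} (upper_RL_integrand \<mu> f x)"
  using integrable_upper_RL_kernel_mult[OF assms]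
  by (simp add: set_integrable_def indicator_upper_RL_integrand[OF assms(1,3)]
      integrable_restrict_space)

lemma upper_RL_eq_integral_kernel:
  assumes "0 \<le> y" "x \<in> {0..b}"
  shows "upper_RL \<mu> y f x =
    1 / Gamma \<mu> * (LINT t|lebesgue_on {0..b}. upper_RL_kernel \<mu> y x t * f t)"
  by (simp add: upper_RL_def set_lebesgue_integral_def indicator_upper_RL_integrand[OF assms]
      integral_restrict_space)

lemma norm_upper_RL_le:
  assumes "0 \<le> y" "Re \<mu> > 1" "x \<in> {0..b}" and f: "integrable (lebesgue_on {0..b}) f"
  shows "norm (upper_RL \<mu> y f x) \<le>
    norm (1 / Gamma \<mu>) * b powr (Re \<mu> - 1) * (LINT t|lebesgue_on {0..b}. norm (f t))"
proof -
  have "norm (LINT t|lebesgue_on {0..b}. upper_RL_kernel \<mu> y x t * f t)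
      \<le> (LINT t|lebesgue_on {0..b}. norm (upper_RL_kernel \<mu> y x t * f t))"
    by (rule integral_norm_bound)
  also have "\<dots> \<le> (LINT t|lebesgue_on {0..b}. b powr (Re \<mu> - 1) * norm (f t))"
  proof (rule integral_mono)
    show "integrable (lebesgue_on {0..b}) (\<lambda>t. norm (upper_RL_kernel \<mu> y x t * f t))"
      using integrable_upper_RL_kernel_mult[OF assms] by (rule integrable_norm)
  qed (use f norm_upper_RL_kernel_le[of y x b \<mu>] assms in
      \<open>simp_all add: norm_mult mult_right_mono\<close>)
  finally have "norm (LINT t|lebesgue_on {0..b}. upper_RL_kernel \<mu> y x t * f t)
      \<le> b powr (Re \<mu> - 1) * (LINT t|lebesgue_on {0..b}. norm (f t))"
    by simp
  then show ?thesis
    unfolding upper_RL_eq_integral_kernel[OF assms(1,3)] norm_mult mult.assoc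
    by (rule mult_left_mono) simp
qed

text \<open>
  As the first argument of the kernel tends to \<open>x\<close>, the integrands converge for every \<open>t\<close> but the
  end points \<open>y * x\<close> and \<open>x\<close> of the domain of integration, and
  \<open>b powr (Re \<mu> - 1) * norm (f t)\<close> dominates them.
\<close>

lemma continuous_on_upper_RL:
  assumes "0 \<le> y" "Re \<mu> > 1" and f: "integrable (lebesgue_on {0..b}) f"
  shows "continuous_on {0..b} (upper_RL \<mu> y f)"
  unfolding continuous_on_sequentially
proof (intro allI ballI impI, elim conjE)
  fix u x assume u: "\<forall>n. u n \<in> {0..b}" and x: "x \<in> {0..b}" and lim: "u \<longlonglongrightarrow> x"
  have "(\<lambda>n. LINT t|lebesgue_on {0..b}. upper_RL_kernel \<mu> y (u n) t * f t)
      \<longlonglongrightarrow> (LINT t|lebesgue_on {0..b}. upper_RL_kernel \<mu> y x t * f t)"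
  proof (rule integral_dominated_convergence)
    show "integrable (lebesgue_on {0..b}) (\<lambda>t. b powr (Re \<mu> - 1) * norm (f t))"
      using f by simp
    have "AE t in lebesgue. t \<noteq> x \<and> t \<noteq> y * x"
      using AE_completion[OF AE_lborel_singleton[of x]]
        AE_completion[OF AE_lborel_singleton[of "y * x"]] by simp
    then have "AE t in lebesgue_on {0..b}. t \<noteq> x \<and> t \<noteq> y * x"
      by (subst AE_restrict_space_iff) auto
    then show "AE t in lebesgue_on {0..b}.
        (\<lambda>n. upper_RL_kernel \<mu> y (u n) t * f t) \<longlonglongrightarrow> upper_RL_kernel \<mu> y x t * f t"
    proof eventually_elim
      case (elim t)
      then have "isCont (\<lambda>x. upper_RL_kernel \<mu> y x t) x"
        by (simp add: isCont_upper_RL_kernel)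
      from isCont_tendsto_compose[OF this lim] show ?case
        by (rule tendsto_mult_right)
    qed
    show "AE t in lebesgue_on {0..b}. norm (upper_RL_kernel \<mu> y (u n) t * f t)
        \<le> b powr (Re \<mu> - 1) * norm (f t)" for n
      using norm_upper_RL_kernel_le[of y "u n" b \<mu>] u assms
      by (intro AE_I2) (simp add: norm_mult mult_right_mono)
  qed (use u x assms in \<open>auto intro!: borel_measurable_integrable integrable_upper_RL_kernel_mult\<close>)
  from tendsto_mult_left[OF this, of "1 / Gamma \<mu>"]
  show "(upper_RL \<mu> y f \<circ> u) \<longlonglongrightarrow> upper_RL \<mu> y f x"
    using u x assms(1) by (simp add: upper_RL_eq_integral_kernel[where b = b] o_def)
qed

lemma integrable_upper_RL:
  assumes "0 \<le> y" "Re \<mu> > 1" "integrable (lebesgue_on {0..b}) f"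
  shows "integrable (lebesgue_on {0..b}) (upper_RL \<mu> y f)"
  using continuous_on_upper_RL[OF assms] by (rule continuous_imp_integrable_real)

lemma integral_norm_upper_RL_le:
  assumes "0 \<le> b" "0 \<le> y" "Re \<mu> > 1" and f: "integrable (lebesgue_on {0..b}) f"
  shows "(LINT x|lebesgue_on {0..b}. norm (upper_RL \<mu> y f x)) \<le>
    b * norm (1 / Gamma \<mu>) * b powr (Re \<mu> - 1) * (LINT t|lebesgue_on {0..b}. norm (f t))"
proof -
  define B where
    "B = norm (1 / Gamma \<mu>) * b powr (Re \<mu> - 1) * (LINT t|lebesgue_on {0..b}. norm (f t))"
  have "(LINT x|lebesgue_on {0..b}. norm (upper_RL \<mu> y f x)) \<le> (LINT x|lebesgue_on {0..b}. B)"
  proof (rule integral_mono)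
    show "integrable (lebesgue_on {0..b}) (\<lambda>x. norm (upper_RL \<mu> y f x))"
      using integrable_upper_RL[OF assms(2-4)] by (rule integrable_norm)
  qed (use norm_upper_RL_le[OF assms(2,3) _ f] in \<open>simp_all add: B_def\<close>)
  also have "\<dots> = b * B"
    using assms(1) by (simp add: measure_restrict_space)
  finally show ?thesis
    by (simp add: B_def mult.assoc)
qed

theorem theorem2p2:
  fixes b y :: real and \<mu> :: complex
  assumes "b > 0" and "0 < y" and "y < 1" and "Re \<mu> > 1"
  shows "(\<forall>f. integrable (lebesgue_on {0..b}) f \<longrightarrow>
            (\<forall>x\<in>{0..b}. set_integrable lebesgue {y * x..x} (upper_RL_integrand \<mu> f x)) \<and>
            integrable (lebesgue_on {0..b}) (upper_RL \<mu> y f)) \<and>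
         (\<lambda>f. L1_class (lebesgue_on {0..b}) (upper_RL \<mu> y f)) respects L1_rel (lebesgue_on {0..b}) \<and>
         L1_bounded_linear (lebesgue_on {0..b}) (L1_lift (lebesgue_on {0..b}) (upper_RL \<mu> y))"
proof -
  let ?M = "lebesgue_on {0..b}"
  have y: "0 \<le> y" and b: "0 \<le> b"
    using assms by auto
  note kernel_int = integrable_upper_RL_kernel_mult[OF y \<open>Re \<mu> > 1\<close>]
  note RL_int = integrable_upper_RL[OF y \<open>Re \<mu> > 1\<close>]
  note RL_eq = upper_RL_eq_integral_kernel[OF y]
  have cong: "upper_RL \<mu> y f x = upper_RL \<mu> y g x"
    if "integrable ?M f" "integrable ?M g" "AE t in ?M. f t = g t" "x \<in> space ?M" for f g x
  proof -
    have x: "x \<in> {0..b}"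
      using that(4) by simp
    have "(LINT t|?M. upper_RL_kernel \<mu> y x t * f t) = (LINT t|?M. upper_RL_kernel \<mu> y x t * g t)"
      using that(3) kernel_int[OF x that(1)] kernel_int[OF x that(2)]
      by (intro integral_cong_AE) (auto elim: eventually_mono)
    then show ?thesis
      by (simp add: RL_eq[OF x])
  qed
  have add: "upper_RL \<mu> y (\<lambda>t. f t + g t) x = upper_RL \<mu> y f x + upper_RL \<mu> y g x"
    if "integrable ?M f" "integrable ?M g" "x \<in> space ?M" for f g x
    using that kernel_int[of x b f] kernel_int[of x b g]
    by (simp add: RL_eq[of x b] distrib_left add_divide_distrib)
  have scale: "upper_RL \<mu> y (\<lambda>t. c * f t) x = c * upper_RL \<mu> y f x"
    if "integrable ?M f" "x \<in> space ?M" for c f x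
    using that kernel_int[of x b f]
    by (simp add: RL_eq[of x b] mult.left_commute[of _ c])
  note lifted = L1_lift_bounded_linear[where M = ?M and A = "upper_RL \<mu> y",
      OF RL_int cong add scale integral_norm_upper_RL_le[OF b y \<open>Re \<mu> > 1\<close>]]
  show ?thesis
    using set_integrable_upper_RL_integrand[OF y \<open>Re \<mu> > 1\<close>] RL_int lifted by blast
qed

end
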